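(* Let $X$ be a centered, nondegenerate, infinitely divisible real random variable with finite variance $V>0$. For all $b>0$ and $s>0$: $$c_+(-X)=c_-(X),\quad c_-(-X)=c_+(X),\qquad c_+(bX)=b\,c_+(X),\quad c_-(bX)=b\,c_-(X).$$ If $X_s$ is the time-$s$ marginal of a Lévy process whose time-one marginal is $X$, then $$c_+(X_s)=c_+(X),\qquad c_-(X_s)=c_-(X).$$ These identities hold in $[0,\infty]$ (the value $\infty$ is allowed).
   Context: For a centered, nondegenerate, infinitely divisible random variable $W$ with finite variance $V_W>0$, let $K_W(t)=\log\mathbb{E}e^{tW}\in[0,\infty]$. Define $c_+(W)$ as the infimum of all $c\ge0$ such that $K_W(t)\le\frac{V_Wt^2}{2(1-ct)}$ for every $0\le t<1/c$ (with $1/0=\infty$ and $\inf\emptyset=\infty$), and $c_-(W)=c_+(-W)$. *)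

theory Defs
  imports "HOL-Probability.Probability"
begin

text \<open>A law on the real line is infinitely divisible if for every \<open>n \<ge> 1\<close> it is the law of the sum of
  \<open>n\<close> i.i.d. random variables.  The i.i.d. sample is realised canonically, as the coordinates of
  the \<open>n\<close>-fold product of the common law \<open>\<nu>\<close>, so that no quantification over sample spaces is needed.\<close>

definition infinitely_divisible :: "real measure \<Rightarrow> bool" where
  "infinitely_divisible \<mu> \<longleftrightarrow>
     (\<forall>n::nat. n \<ge> 1 \<longrightarrow>
        (\<exists>\<nu>. real_distribution \<nu> \<and>
             \<mu> = distr (Pi\<^sub>M {..<n} (\<lambda>_. \<nu>)) borel (\<lambda>y. \<Sum>i<n. y i)))"

text \<open>The cumulant generating function.  The expectation is taken as a nonnegative integral, so the
  value \<open>\<infinity>\<close> is a genuine one; the argument of \<^const>\<open>ln\<close> is positive whenever \<open>W\<close> is a random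
  variable on a probability space.\<close>

definition cumulant :: "'a measure \<Rightarrow> ('a \<Rightarrow> real) \<Rightarrow> real \<Rightarrow> ereal" where
  "cumulant M W t =
     (let m = (\<integral>\<^sup>+ \<omega>. ennreal (exp (t * W \<omega>)) \<partial>M)
      in if m = \<infinity> then \<infinity> else ereal (ln (enn2real m)))"

text \<open>The condition \<open>t < 1 / c\<close> is read in \<^typ>\<open>ereal\<close>, where \<open>1 / 0 = \<infinity>\<close>; the infimum is taken in
  \<^typ>\<open>ennreal\<close>, where \<open>Inf {} = \<infinity>\<close>.\<close>

definition c_plus :: "'a measure \<Rightarrow> ('a \<Rightarrow> real) \<Rightarrow> ennreal" where
  "c_plus M W =
     Inf {ennreal c | c::real. c \<ge> 0 \<and>
       (\<forall>t::real. 0 \<le> t \<and> ereal t < 1 / ereal c \<longrightarrow>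
          cumulant M W t \<le> ereal (prob_space.variance M W * t\<^sup>2 / (2 * (1 - c * t))))}"

definition c_minus :: "'a measure \<Rightarrow> ('a \<Rightarrow> real) \<Rightarrow> ennreal" where
  "c_minus M W = c_plus M (\<lambda>\<omega>. - W \<omega>)"

text \<open>Only the values of \<open>L\<close> at times \<open>t \<ge> 0\<close> matter.  The clauses are, in order: measurability,
  start at zero, independent increments, stationary increments, stochastic continuity, and
  almost surely right-continuous paths with left limits.\<close>

definition levy_process :: "'a measure \<Rightarrow> (real \<Rightarrow> 'a \<Rightarrow> real) \<Rightarrow> bool" where
  "levy_process N L \<longleftrightarrow>
     prob_space N \<and>
     (\<forall>t\<ge>0. L t \<in> borel_measurable N) \<and>
     (AE \<omega> in N. L 0 \<omega> = 0) \<and>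
     (\<forall>(n::nat) \<tau>. 0 \<le> \<tau> 0 \<and> (\<forall>i<n. \<tau> i < \<tau> (Suc i)) \<longrightarrow>
        prob_space.indep_vars N (\<lambda>_. borel) (\<lambda>i \<omega>. L (\<tau> (Suc i)) \<omega> - L (\<tau> i) \<omega>) {..<n}) \<and>
     (\<forall>s\<ge>0. \<forall>h\<ge>0. distr N borel (\<lambda>\<omega>. L (s + h) \<omega> - L s \<omega>) = distr N borel (L h)) \<and>
     (\<forall>t\<ge>0. \<forall>\<epsilon>>0.
        ((\<lambda>s. measure N {\<omega> \<in> space N. \<bar>L s \<omega> - L t \<omega>\<bar> > \<epsilon>}) \<longlongrightarrow> 0) (at t within {0..})) \<and>
     (AE \<omega> in N. \<forall>t\<ge>0. ((\<lambda>s. L s \<omega>) \<longlongrightarrow> L t \<omega>) (at_right t) \<and>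
        (t > 0 \<longrightarrow> (\<exists>l. ((\<lambda>s. L s \<omega>) \<longlongrightarrow> l) (at_left t))))"

end

theory Submission
  imports Defs
begin

text \<open>
  The defining inequality of \<^const>\<open>c_plus\<close> depends on \<open>W\<close> only through its cumulant generating
  function \<open>K\<close> and its variance \<open>V\<close>. Replacing \<open>W\<close> by \<open>b W\<close> amounts to substituting \<open>b t\<close> for \<open>t\<close>.
  For a Levy process, \<open>K\<close> and \<open>V\<close> at time \<open>s\<close> are \<open>s\<close> times those at time \<open>1\<close>, so both sides of the
  inequality are multiplied by \<open>s\<close>. Both are additive in \<open>s\<close>; the variance is moreover nonnegative,
  which forces linearity. For \<open>K\<close>, which may be infinite or negative, right-continuity of paths and
  Fatou's lemma give \<open>K\<^sub>s \<le> s K\<^sub>1\<close>, so that \<open>s K\<^sub>1 - K\<^sub>s\<close> is again additive and nonnegative.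
\<close>

section \<open>Additive functions on the positive half-line\<close>

text \<open>Integer multiples come from iterating additivity; applying them to
  \<open>x / real n\<close> with the multipliers \<open>n\<close> and \<open>k\<close> gives the
  fraction. All arguments stay positive, where additivity is available.\<close>

lemma additive_rat_multiple:
  fixes f :: "real \<Rightarrow> real"
  assumes add: "\<And>s h. 0 < s \<Longrightarrow> 0 < h \<Longrightarrow> f (s + h) = f s + f h"
    and "0 < x" "0 < k" "0 < n"
  shows "f (real k / real n * x) = real k / real n * f x"
proof -
  have nat_multiple: "f (real (Suc m) * y) = real (Suc m) * f y" if "0 < y" for m y
  proof (induction m)
    case (Suc m)
    have "f (real (Suc (Suc m)) * y) = f (real (Suc m) * y + y)"
      by (simp add: algebra_simps)
    also have "\<dots> = f (real (Suc m) * y) + f y"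
      using that by (intro add) auto
    finally show ?case
      using Suc by (simp add: algebra_simps)
  qed simp
  then have mult: "f (real m * y) = real m * f y" if "0 < y" "0 < m" for m y
    using that by (metis gr0_implies_Suc)
  have "real n * f (x / real n) = f x"
    using mult[of "x / real n" n] assms by simp
  moreover have "f (real k / real n * x) = real k * f (x / real n)"
    using mult[of "x / real n" k] assms by (simp add: mult.commute)
  ultimately show ?thesis
    using \<open>0 < n\<close> by (simp add: field_simps)
qed

text \<open>Nonnegativity turns additivity into monotonicity, and a monotone solution of Cauchy's
  equation is squeezed between its values at neighbouring fractions.\<close>

lemma additive_nonneg_imp_linear:
  fixes f :: "real \<Rightarrow> real"
  assumes add: "\<And>s h. 0 < s \<Longrightarrow> 0 < h \<Longrightarrow> f (s + h) = f s + f h"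
    and nonneg: "\<And>s. 0 < s \<Longrightarrow> 0 \<le> f s" and "0 < s"
  shows "f s = s * f 1"
proof -
  have mono: "f x \<le> f y" if "0 < x" "x < y" for x y
    using add[of x "y - x"] nonneg[of "y - x"] that by simp
  have rat: "f (real k / real n) = real k / real n * f 1" if "0 < k" "0 < n" for k n
    using additive_rat_multiple[of f 1 k n] add that by simp
  have "0 \<le> f 1" using nonneg by simp
  \<comment> \<open>Both \<open>f s\<close> and \<open>s * f 1\<close> lie between the multiples of
    \<open>f 1\<close> by \<open>k / n\<close> and \<open>(k + 1) / n\<close>; the factor 2 is
    slack. The bound \<open>1 / s\<close> on \<open>n\<close> makes \<open>k\<close>
    positive.\<close>
  have close: "\<bar>f s - s * f 1\<bar> \<le> 2 * f 1 / real n" if n: "real n > 1 / s" "0 < n" for n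
  proof -
    define k where "k = nat \<lfloor>s * real n\<rfloor>"
    have "s * real n > 1"
      using n \<open>0 < s\<close> by (simp add: field_simps)
    then have "0 < k" and k: "real k \<le> s * real n" "s * real n < real k + 1"
      unfolding k_def by linarith+
    then have le: "real k / real n \<le> s" "s < real (Suc k) / real n"
      using n by (simp_all add: field_simps)
    have low: "f (real k / real n) \<le> f s"
      using mono[of "real k / real n" s] le \<open>0 < k\<close> n by (cases "real k / real n = s") auto
    have up: "f s \<le> f (real (Suc k) / real n)"
      using mono \<open>0 < s\<close> le by auto
    have "real k / real n * f 1 \<le> s * f 1" "s * f 1 \<le> real (Suc k) / real n * f 1"
      using le \<open>0 \<le> f 1\<close> by (intro mult_right_mono; simp)+
    moreover have "real (Suc k) / real n * f 1 = real k / real n * f 1 + f 1 / real n"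
      by (simp add: add_divide_distrib distrib_right)
    moreover have "0 \<le> f 1 / real n"
      using \<open>0 \<le> f 1\<close> by simp
    moreover have "2 * f 1 / real n = 2 * (f 1 / real n)"
      by simp
    ultimately show ?thesis
      using low up rat[of k n] rat[of "Suc k" n] \<open>0 < k\<close> n by linarith
  qed
  have "(\<lambda>n. 2 * f 1 / real n) \<longlonglongrightarrow> 0"
    by (intro tendsto_divide_0[OF tendsto_const] filterlim_at_top_imp_at_infinity filterlim_real_sequentially)
  moreover have "\<forall>\<^sub>F n in sequentially. \<bar>f s - s * f 1\<bar> \<le> 2 * f 1 / real n"
    using filterlim_real_sequentially[unfolded filterlim_at_top_dense, rule_format, of "1 / s"]
      eventually_gt_at_top[of 0]
    by eventually_elim (rule close)
  ultimately have "\<bar>f s - s * f 1\<bar> \<le> 0"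
    by (intro tendsto_lowerbound) auto
  then show ?thesis by simp
qed

section \<open>Exponential moments and variances\<close>

text \<open>Keeping the value in \<open>ennreal\<close> lets the product rule for convolutions hold
  even when a factor is infinite.\<close>

definition mgf :: "'a measure \<Rightarrow> ('a \<Rightarrow> real) \<Rightarrow> real \<Rightarrow> ennreal" where
  "mgf M W t = (\<integral>\<^sup>+ \<omega>. ennreal (exp (t * W \<omega>)) \<partial>M)"

lemma cumulant_mgf:
  "cumulant M W t = (if mgf M W t = \<infinity> then \<infinity> else ereal (ln (enn2real (mgf M W t))))"
  by (simp add: cumulant_def mgf_def Let_def)

lemma mgf_distr:
  assumes "W \<in> borel_measurable M"
  shows "mgf (distr M borel W) (\<lambda>x. x) t = mgf M W t"
  using assms by (simp add: mgf_def nn_integral_distr)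

text \<open>A vanishing integral would force the strictly positive exponential to vanish almost
  everywhere. Positivity is what later permits cancelling factors and taking logarithms.\<close>

lemma (in prob_space) mgf_pos:
  assumes "W \<in> borel_measurable M"
  shows "mgf M W t > 0"
proof -
  have "mgf M W t \<noteq> 0"
    unfolding mgf_def using assms by (subst nn_integral_0_iff_AE) auto
  then show ?thesis by (simp add: zero_less_iff_neq_zero)
qed

lemma mgf_convolution:
  assumes "finite_measure \<mu>" "finite_measure \<nu>"
    and [measurable_cong, simp]: "sets \<mu> = sets borel" "sets \<nu> = sets borel"
  shows "mgf (\<mu> \<star> \<nu>) (\<lambda>x. x) t = mgf \<mu> (\<lambda>x. x) t * mgf \<nu> (\<lambda>x. x) t"
proof -
  have "mgf (\<mu> \<star> \<nu>) (\<lambda>x. x) t = (\<integral>\<^sup>+x. \<integral>\<^sup>+y. ennreal (exp (t * (x + y))) \<partial>\<nu> \<partial>\<mu>)"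
    unfolding mgf_def using assms by (subst nn_integral_convolution) auto
  also have "\<dots> = (\<integral>\<^sup>+x. \<integral>\<^sup>+y. ennreal (exp (t * x)) * ennreal (exp (t * y)) \<partial>\<nu> \<partial>\<mu>)"
    by (simp add: distrib_left exp_add ennreal_mult)
  also have "\<dots> = mgf \<mu> (\<lambda>x. x) t * mgf \<nu> (\<lambda>x. x) t"
    unfolding mgf_def by (simp add: nn_integral_cmult nn_integral_multc)
  finally show ?thesis .
qed

lemma (in prob_space) integrable_of_square:
  fixes X :: "'a \<Rightarrow> real"
  assumes [measurable]: "random_variable borel X" and "integrable M (\<lambda>\<omega>. (X \<omega>)\<^sup>2)"
  shows "integrable M X"
proof (rule Bochner_Integration.integrable_bound)
  show "integrable M (\<lambda>\<omega>. 1 + (X \<omega>)\<^sup>2)"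
    using assms by simp
  \<comment> \<open>Expanding the square of \<open>\<bar>x\<bar> - 1\<close> bounds
    \<open>2 * \<bar>x\<bar>\<close> by \<open>1 + x\<^sup>2\<close>.\<close>
  have "\<bar>x\<bar> \<le> 1 + x\<^sup>2" for x :: real
    using zero_le_power2[of "\<bar>x\<bar> - 1"] zero_le_power2[of x] unfolding power2_diff power2_abs
    by (simp del: zero_le_power2)
  then show "AE \<omega> in M. norm (X \<omega>) \<le> norm (1 + (X \<omega>)\<^sup>2)"
    by (auto simp: abs_of_nonneg)
qed simp

lemma integrable_square_translate:
  fixes \<mu> :: "real measure"
  assumes "prob_space \<mu>" and [measurable_cong]: "sets \<mu> = sets borel"
    and "integrable \<mu> (\<lambda>x. (x + y)\<^sup>2)"
  shows "integrable \<mu> (\<lambda>x. x\<^sup>2)"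
proof -
  interpret prob_space \<mu> by fact
  have "integrable \<mu> (\<lambda>x. x + y)"
    using assms(3) by (rule integrable_of_square[rotated]) measurable
  \<comment> \<open>This is the expansion of the square of \<open>(x + y) - y\<close>, in which
    every term is known to be integrable.\<close>
  then have "integrable \<mu> (\<lambda>x. (x + y)\<^sup>2 - 2 * y * (x + y) + y\<^sup>2)"
    using assms(3) by (intro Bochner_Integration.integrable_add Bochner_Integration.integrable_diff) auto
  moreover have "(\<lambda>x. (x + y)\<^sup>2 - 2 * y * (x + y) + y\<^sup>2) = (\<lambda>x. x\<^sup>2)"
    by (auto simp: power2_eq_square algebra_simps)
  ultimately show ?thesis by simp
qed

text \<open>By Fubini, some translate of \<open>x\<close> is square-integrable.\<close>

lemma integrable_square_convolutionD:
  fixes \<mu> \<nu> :: "real measure"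
  assumes "prob_space \<mu>" "prob_space \<nu>"
    and [measurable_cong, simp]: "sets \<mu> = sets borel" "sets \<nu> = sets borel"
    and int: "integrable (\<mu> \<star> \<nu>) (\<lambda>x. x\<^sup>2)"
  shows "integrable \<nu> (\<lambda>x. x\<^sup>2)"
proof -
  interpret \<mu>: prob_space \<mu> by fact
  interpret \<nu>: prob_space \<nu> by fact
  have "(\<integral>\<^sup>+x. \<integral>\<^sup>+y. ennreal ((x + y)\<^sup>2) \<partial>\<nu> \<partial>\<mu>) = (\<integral>\<^sup>+x. ennreal (x\<^sup>2) \<partial>(\<mu> \<star> \<nu>))"
    by (subst nn_integral_convolution) (auto intro: \<mu>.finite_measure_axioms \<nu>.finite_measure_axioms)
  also have "\<dots> < \<infinity>"
    using int by (simp add: integrable_iff_bounded)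
  finally have "AE x in \<mu>. (\<integral>\<^sup>+y. ennreal ((x + y)\<^sup>2) \<partial>\<nu>) \<noteq> \<infinity>"
    by (intro nn_integral_PInf_AE) auto
  then have "\<exists>x. (\<integral>\<^sup>+y. ennreal ((x + y)\<^sup>2) \<partial>\<nu>) \<noteq> \<infinity>"
    by (intro eventually_happens'[OF \<mu>.ae_filter_bot])
  then obtain x where "(\<integral>\<^sup>+y. ennreal ((x + y)\<^sup>2) \<partial>\<nu>) \<noteq> \<infinity>"
    by blast
  then have "integrable \<nu> (\<lambda>y. (y + x)\<^sup>2)"
    by (intro integrableI_bounded) (auto simp: add.commute less_top)
  then show ?thesis
    using integrable_square_translate[OF assms(2)] by simp
qed

text \<open>Independence makes the cross term integrable and factorises its expectation. The first
  conclusion serves the induction over integer times.\<close>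

lemma (in prob_space) variance_add_indep:
  fixes X Y :: "'a \<Rightarrow> real"
  assumes ind: "indep_var borel X borel Y"
    and X2: "integrable M (\<lambda>\<omega>. (X \<omega>)\<^sup>2)" and Y2: "integrable M (\<lambda>\<omega>. (Y \<omega>)\<^sup>2)"
  shows "integrable M (\<lambda>\<omega>. (X \<omega> + Y \<omega>)\<^sup>2)"
    and "variance (\<lambda>\<omega>. X \<omega> + Y \<omega>) = variance X + variance Y"
proof -
  have [measurable]: "random_variable borel X" "random_variable borel Y"
    using ind indep_var_rv1 indep_var_rv2 by blast+
  have X: "integrable M X" and Y: "integrable M Y"
    using integrable_of_square[OF _ X2] integrable_of_square[OF _ Y2] by simp_all
  have XY: "integrable M (\<lambda>\<omega>. X \<omega> * Y \<omega>)"
    and eq: "expectation (\<lambda>\<omega>. X \<omega> * Y \<omega>) = expectation X * expectation Y"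
    using indep_var_integrable[OF ind X Y] indep_var_lebesgue_integral[OF ind X Y] by auto
  have sq: "(\<lambda>\<omega>. (X \<omega> + Y \<omega>)\<^sup>2) = (\<lambda>\<omega>. (X \<omega>)\<^sup>2 + (Y \<omega>)\<^sup>2 + 2 * (X \<omega> * Y \<omega>))"
    by (auto simp: power2_sum)
  show int: "integrable M (\<lambda>\<omega>. (X \<omega> + Y \<omega>)\<^sup>2)"
    unfolding sq using X2 Y2 XY by auto
  have "expectation (\<lambda>\<omega>. (X \<omega> + Y \<omega>)\<^sup>2) =
      expectation (\<lambda>\<omega>. (X \<omega>)\<^sup>2) + expectation (\<lambda>\<omega>. (Y \<omega>)\<^sup>2) + 2 * (expectation X * expectation Y)"
    unfolding sq eq[symmetric] using X2 Y2 XY by simp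
  then show "variance (\<lambda>\<omega>. X \<omega> + Y \<omega>) = variance X + variance Y"
    unfolding variance_eq[OF X X2] variance_eq[OF Y Y2]
      variance_eq[OF Bochner_Integration.integrable_add[OF X Y] int]
    using X Y by (simp add: power2_sum)
qed

lemma variance_distr:
  fixes W :: "'a \<Rightarrow> real"
  assumes "W \<in> borel_measurable M"
  shows "prob_space.variance (distr M borel W) (\<lambda>x. x) = prob_space.variance M W"
  using assms by (simp add: integral_distr)

section \<open>Levy processes\<close>

locale levy = prob_space N for N :: "'b measure" +
  fixes L :: "real \<Rightarrow> 'b \<Rightarrow> real"
  assumes levy: "levy_process N L"
begin

section \<open>Marginal laws as a convolution semigroup\<close>

lemma measurable_L: "0 \<le> t \<Longrightarrow> L t \<in> borel_measurable N"
  using levy by (simp add: levy_process_def)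

text \<open>Stationarity identifies increments with marginals only in distribution, so facts are
  carried from one to the other through this measure.\<close>

definition law :: "real \<Rightarrow> real measure" where
  "law s = distr N borel (L s)"

lemma sets_law [simp, measurable_cong]: "sets (law s) = sets borel"
  by (simp add: law_def)

lemma prob_space_law: "0 \<le> s \<Longrightarrow> prob_space (law s)"
  unfolding law_def by (intro prob_space_distr measurable_L)

lemma mgf_law: "0 \<le> s \<Longrightarrow> mgf (law s) (\<lambda>x. x) t = mgf N (L s) t"
  unfolding law_def by (intro mgf_distr measurable_L)

lemma variance_law:
  "0 \<le> s \<Longrightarrow> prob_space.variance (law s) (\<lambda>x. x) = variance (L s)"
  unfolding law_def by (intro variance_distr measurable_L)

lemma distr_increment:
  "0 \<le> s \<Longrightarrow> 0 \<le> h \<Longrightarrow> distr N borel (\<lambda>\<omega>. L (s + h) \<omega> - L s \<omega>) = law h"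
  using levy by (simp add: levy_process_def law_def)

lemma indep_increments:
  assumes "0 < s" "0 < h"
  shows "indep_var borel (\<lambda>\<omega>. L s \<omega> - L 0 \<omega>) borel (\<lambda>\<omega>. L (s + h) \<omega> - L s \<omega>)"
proof -
  \<comment> \<open>The partition 0, \<open>s\<close>, \<open>s + h\<close>; only the indices up to
    2 are constrained.\<close>
  define \<tau> :: "nat \<Rightarrow> real" where "\<tau> i = (if i = 0 then 0 else if i = 1 then s else s + h)" for i
  have "0 \<le> \<tau> 0 \<and> (\<forall>i<2. \<tau> i < \<tau> (Suc i))"
    using assms by (auto simp: \<tau>_def)
  then have "indep_vars (\<lambda>_. borel) (\<lambda>i \<omega>. L (\<tau> (Suc i)) \<omega> - L (\<tau> i) \<omega>) {..<2}"
    using levy unfolding levy_process_def by blast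
  moreover have "{..<2} = insert 0 {1::nat}" by auto
  ultimately show ?thesis
    \<comment> \<open>A sum over a singleton converts independence of the two-element family into
      independence of a pair.\<close>
    using indep_vars_sum[of "{1::nat}" 0 "\<lambda>i \<omega>. L (\<tau> (Suc i)) \<omega> - L (\<tau> i) \<omega>"]
    by (simp add: \<tau>_def)
qed

text \<open>Two adjacent independent increments add up to the increment over the whole interval.
  Stationarity from time 0 replaces \<open>L u - L 0\<close> by \<open>L u\<close> in law.\<close>

lemma law_add:
  assumes "0 < s" "0 < h"
  shows "law (s + h) = (law s \<star> law h)"
proof -
  have [measurable]: "L 0 \<in> borel_measurable N" "L s \<in> borel_measurable N" "L (s + h) \<in> borel_measurable N"
    using assms by (auto intro: measurable_L)
  have "law (s + h) = distr N borel (\<lambda>\<omega>. L (s + h) \<omega> - L 0 \<omega>)"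
    using distr_increment[of 0 "s + h"] assms by simp
  also have "\<dots> = distr N borel (\<lambda>\<omega>. (L s \<omega> - L 0 \<omega>) + (L (s + h) \<omega> - L s \<omega>))"
    by simp
  also have "\<dots> = (distr N borel (\<lambda>\<omega>. L s \<omega> - L 0 \<omega>) \<star> distr N borel (\<lambda>\<omega>. L (s + h) \<omega> - L s \<omega>))"
    by (intro sum_indep_random_variable indep_increments assms) auto
  also have "\<dots> = (law s \<star> law h)"
    using distr_increment[of 0 s] distr_increment[of s h] assms by simp
  finally show ?thesis .
qed

subsection \<open>Variance\<close>

lemma increment_square_integrable_iff:
  assumes "0 \<le> s" "0 \<le> h"
  shows "integrable N (\<lambda>\<omega>. (L (s + h) \<omega> - L s \<omega>)\<^sup>2) \<longleftrightarrow> integrable (law h) (\<lambda>x. x\<^sup>2)"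
proof -
  have [measurable]: "L s \<in> borel_measurable N" "L (s + h) \<in> borel_measurable N"
    using assms by (auto intro: measurable_L)
  show ?thesis
    unfolding distr_increment[OF assms, symmetric] by (subst integrable_distr_eq) auto
qed

lemma variance_increment:
  assumes "0 \<le> s" "0 \<le> h"
  shows "variance (\<lambda>\<omega>. L (s + h) \<omega> - L s \<omega>) = variance (L h)"
proof -
  have [measurable]: "L s \<in> borel_measurable N" "L (s + h) \<in> borel_measurable N"
    using assms by (auto intro: measurable_L)
  have "variance (\<lambda>\<omega>. L (s + h) \<omega> - L s \<omega>) =
      prob_space.variance (distr N borel (\<lambda>\<omega>. L (s + h) \<omega> - L s \<omega>)) (\<lambda>x. x)"
    by (intro variance_distr[symmetric]) auto
  then show ?thesis
    unfolding distr_increment[OF assms] using variance_law assms by simp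
qed

lemma square_integrable_add:
  assumes "0 < s" "0 < h" "integrable (law s) (\<lambda>x. x\<^sup>2)" "integrable (law h) (\<lambda>x. x\<^sup>2)"
  shows "integrable (law (s + h)) (\<lambda>x. x\<^sup>2)" "variance (L (s + h)) = variance (L s) + variance (L h)"
proof -
  have X: "integrable N (\<lambda>\<omega>. (L s \<omega> - L 0 \<omega>)\<^sup>2)"
    using increment_square_integrable_iff[of 0 s] assms by simp
  have Y: "integrable N (\<lambda>\<omega>. (L (s + h) \<omega> - L s \<omega>)\<^sup>2)"
    using increment_square_integrable_iff[of s h] assms by simp
  note add = variance_add_indep[OF indep_increments[OF assms(1,2)] X Y]
  show "integrable (law (s + h)) (\<lambda>x. x\<^sup>2)"
    using increment_square_integrable_iff[of 0 "s + h"] add(1) assms by simp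
  show "variance (L (s + h)) = variance (L s) + variance (L h)"
    using add(2) variance_increment[of 0 "s + h"] variance_increment[of 0 s]
      variance_increment[of s h] assms by simp
qed

text \<open>Adding unit steps reaches all positive integers. For general \<open>s\<close>, the law
  at a larger integer \<open>n\<close> is a convolution with \<open>law s\<close> as a factor, and
  the factor inherits square integrability.\<close>

lemma square_integrable:
  assumes "integrable (law 1) (\<lambda>x. x\<^sup>2)" "0 < s"
  shows "integrable (law s) (\<lambda>x. x\<^sup>2)"
proof -
  have nat: "integrable (law (real (Suc n))) (\<lambda>x. x\<^sup>2)" for n
  proof (induction n)
    case (Suc n)
    then show ?case
      using square_integrable_add(1)[of "real (Suc n)" 1] assms by (simp add: add.commute)
  qed (use assms in simp)
  obtain n where n: "s < real n"
    using reals_Archimedean2 by blast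
  then obtain m where "n = Suc m"
    using \<open>0 < s\<close> by (cases n) auto
  with n nat have "integrable (law ((real n - s) + s)) (\<lambda>x. x\<^sup>2)"
    by simp
  then have "integrable (law (real n - s) \<star> law s) (\<lambda>x. x\<^sup>2)"
    using law_add[of "real n - s" s] n \<open>0 < s\<close> by simp
  then show ?thesis
    using n \<open>0 < s\<close> by (intro integrable_square_convolutionD[OF prob_space_law prob_space_law]) auto
qed

lemma variance_linear:
  assumes "integrable (law 1) (\<lambda>x. x\<^sup>2)" "0 < s"
  shows "variance (L s) = s * variance (L 1)"
proof (rule additive_nonneg_imp_linear[of "\<lambda>s. variance (L s)"])
  show "variance (L (s + h)) = variance (L s) + variance (L h)" if "0 < s" "0 < h" for s h
    using square_integrable_add(2)[OF that] square_integrable[OF assms(1)] that by blast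
qed (rule variance_positive assms)+

subsection \<open>Exponential moments\<close>

lemma mgf_L_pos: "0 \<le> s \<Longrightarrow> mgf N (L s) t > 0"
  by (intro mgf_pos measurable_L)

lemma mgf_add:
  assumes "0 < s" "0 < h"
  shows "mgf N (L (s + h)) t = mgf N (L s) t * mgf N (L h) t"
proof -
  have "finite_measure (law s)" "finite_measure (law h)"
    using prob_space_law assms by (auto intro: prob_space.finite_measure)
  then show ?thesis
    using mgf_convolution[of "law s" "law h" t] assms
    by (simp add: mgf_law flip: law_add)
qed

text \<open>The moment at \<open>s\<close> is a factor of the one at \<open>u\<close>, and the other
  factor is nonzero, so an infinite factor would make the product infinite.\<close>

lemma mgf_finite_downward:
  assumes "0 < s" "s < u" "mgf N (L u) t < \<infinity>"
  shows "mgf N (L s) t < \<infinity>"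
proof -
  have "mgf N (L u) t = mgf N (L s) t * mgf N (L (u - s)) t"
    using mgf_add[of s "u - s" t] assms by simp
  moreover have "mgf N (L (u - s)) t \<noteq> 0"
    using mgf_L_pos[of "u - s" t] assms by simp
  ultimately show ?thesis
    using assms by (auto simp: ennreal_mult_eq_top_iff simp flip: less_top)
qed

text \<open>Finiteness at one positive time spreads up along the multiples of \<open>u\<close> and
  then down to any smaller time.\<close>

lemma mgf_finite:
  assumes "0 < s" "0 < u" "mgf N (L u) t < \<infinity>"
  shows "mgf N (L s) t < \<infinity>"
proof -
  have nat: "mgf N (L (real (Suc n) * u)) t < \<infinity>" for n
  proof (induction n)
    case (Suc n)
    have "mgf N (L (real (Suc (Suc n)) * u)) t = mgf N (L (real (Suc n) * u + u)) t"
      by (simp add: algebra_simps)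
    also have "\<dots> = mgf N (L (real (Suc n) * u)) t * mgf N (L u) t"
      using assms by (intro mgf_add) auto
    finally show ?case
      using Suc assms by (simp add: ennreal_mult_less_top)
  qed (use assms in simp)
  obtain n where n: "s / u < real n"
    using reals_Archimedean2 by blast
  moreover obtain m where "n = Suc m"
    using n assms by (cases n) (auto simp: field_simps)
  ultimately show ?thesis
    using mgf_finite_downward[of s "real n * u" t] nat[of m] assms by (simp add: field_simps)
qed

text \<open>Right-continuity gives almost sure convergence along \<open>r\<close>, and Fatou's lemma
  passes it to the integrals.\<close>

lemma mgf_Fatou:
  assumes "0 \<le> s" "\<And>n. s < r n" "r \<longlonglongrightarrow> s"
  shows "mgf N (L s) t \<le> liminf (\<lambda>n. mgf N (L (r n)) t)"
proof -
  \<comment> \<open>The strict inequality matters: \<open>at_right s\<close> excludes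
    \<open>s\<close> itself.\<close>
  have r_lim: "filterlim r (at_right s) sequentially"
    using assms by (auto simp: filterlim_at less_imp_neq[THEN not_sym])
  have "AE \<omega> in N. \<forall>t\<ge>0. ((\<lambda>s. L s \<omega>) \<longlongrightarrow> L t \<omega>) (at_right t) \<and>
      (t > 0 \<longrightarrow> (\<exists>l. ((\<lambda>s. L s \<omega>) \<longlongrightarrow> l) (at_left t)))"
    using levy by (simp add: levy_process_def)
  then have "AE \<omega> in N. ennreal (exp (t * L s \<omega>)) = liminf (\<lambda>n. ennreal (exp (t * L (r n) \<omega>)))"
  proof eventually_elim
    case (elim \<omega>)
    then have "((\<lambda>s. L s \<omega>) \<longlongrightarrow> L s \<omega>) (at_right s)"
      using \<open>0 \<le> s\<close> by blast
    then have "(\<lambda>n. L (r n) \<omega>) \<longlonglongrightarrow> L s \<omega>"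
      using r_lim by (rule filterlim_compose)
    then have "(\<lambda>n. ennreal (exp (t * L (r n) \<omega>))) \<longlonglongrightarrow> ennreal (exp (t * L s \<omega>))"
      by (intro tendsto_intros) auto
    then show ?case
      by (intro lim_imp_Liminf[symmetric]) auto
  qed
  then have "mgf N (L s) t = (\<integral>\<^sup>+\<omega>. liminf (\<lambda>n. ennreal (exp (t * L (r n) \<omega>))) \<partial>N)"
    unfolding mgf_def by (rule nn_integral_cong_AE)
  also have "\<dots> \<le> liminf (\<lambda>n. mgf N (L (r n)) t)"
  proof -
    have "L (r n) \<in> borel_measurable N" for n
      using assms(1) assms(2)[of n] by (intro measurable_L) simp
    then show ?thesis
      unfolding mgf_def by (intro nn_integral_liminf) measurable
  qed
  finally show ?thesis .
qed

lemma ln_mgf_linear: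
  assumes fin: "mgf N (L 1) t < \<infinity>" and "0 < s"
  shows "ln (enn2real (mgf N (L s) t)) = s * ln (enn2real (mgf N (L 1) t))"
proof -
  define f where "f s = ln (enn2real (mgf N (L s) t))" for s
  have pos: "0 < enn2real (mgf N (L s) t)" if "0 < s" for s
    using mgf_L_pos[of s t] mgf_finite[OF that _ fin] that by (simp add: enn2real_positive_iff)
  have mgf_eq: "mgf N (L s) t = ennreal (exp (f s))" if "0 < s" for s
    using pos[OF that] mgf_finite[OF that _ fin] by (simp add: f_def)
  have add: "f (s + h) = f s + f h" if "0 < s" "0 < h" for s h
    unfolding f_def mgf_add[OF that] enn2real_mult
    using pos[OF that(1)] pos[OF that(2)] by (simp add: ln_mult)
  have le: "f s \<le> s * f 1" if "0 < s" for s
  proof -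
    \<comment> \<open>Fractions approach \<open>s\<close> from the right. The \<open>Suc\<close>
      keeps them strictly above \<open>s\<close> even when \<open>s * real (Suc n)\<close> is an
      integer.\<close>
    define k where "k n = Suc (nat \<lfloor>s * real (Suc n)\<rfloor>)" for n
    define r where "r n = real (k n) / real (Suc n)" for n
    have k: "s * real (Suc n) < real (k n)" "real (k n) \<le> s * real (Suc n) + 1" for n
      using \<open>0 < s\<close> mult_pos_pos[of s "real (Suc n)"] unfolding k_def by linarith+
    have r: "s < r n" "r n \<le> s + 1 / real (Suc n)" for n
      using k[of n] by (simp_all add: r_def field_simps del: of_nat_Suc)
    have lim: "r \<longlonglongrightarrow> s"
    proof (rule tendsto_sandwich[of "\<lambda>_. s" _ _ "\<lambda>n. s + 1 / real (Suc n)"])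
      show "(\<lambda>n. s + 1 / real (Suc n)) \<longlonglongrightarrow> s"
        using tendsto_add[OF tendsto_const LIMSEQ_inverse_real_of_nat, of s]
        by (simp add: inverse_eq_divide)
    qed (use r in \<open>auto intro!: always_eventually less_imp_le\<close>)
    have fr: "f (r n) = r n * f 1" for n
      using additive_rat_multiple[of f 1 "k n" "Suc n"] add by (simp add: r_def k_def)
    have "0 < r n" for n using r(1)[of n] \<open>0 < s\<close> by linarith
    then have "(\<lambda>n. mgf N (L (r n)) t) = (\<lambda>n. ennreal (exp (r n * f 1)))"
      by (simp add: mgf_eq fr)
    moreover have "(\<lambda>n. ennreal (exp (r n * f 1))) \<longlonglongrightarrow> ennreal (exp (s * f 1))"
      by (intro tendsto_intros lim)
    ultimately have "liminf (\<lambda>n. mgf N (L (r n)) t) = ennreal (exp (s * f 1))"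
      by (metis lim_imp_Liminf sequentially_bot)
    then have "ennreal (exp (f s)) \<le> ennreal (exp (s * f 1))"
      using mgf_Fatou[OF _ r(1) lim, of t] \<open>0 < s\<close> by (simp add: mgf_eq)
    then show ?thesis by simp
  qed
  \<comment> \<open>The defect from linearity is additive and, by \<open>le\<close>, nonnegative,
    hence linear; since it vanishes at time 1, it vanishes everywhere.\<close>
  have "s * f 1 - f s = s * (1 * f 1 - f 1)"
    by (rule additive_nonneg_imp_linear[of "\<lambda>s. s * f 1 - f s"])
      (use le add \<open>0 < s\<close> in \<open>auto simp: algebra_simps\<close>)
  then show ?thesis
    by (simp add: f_def)
qed

lemma cumulant_linear:
  assumes "0 < s"
  shows "cumulant N (L s) t = ereal s * cumulant N (L 1) t"
proof (cases "mgf N (L 1) t < \<infinity>")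
  case True
  then show ?thesis
    using mgf_finite[OF assms _ True] ln_mgf_linear[OF True assms] by (auto simp: cumulant_mgf)
next
  case False
  \<comment> \<open>A finite moment at \<open>s\<close> would force one at time 1, so both cumulants
    are infinite, and a positive multiple of infinity is infinity.\<close>
  then have "mgf N (L 1) t = \<infinity>" "mgf N (L s) t = \<infinity>"
    using mgf_finite[of 1 s t] assms by (auto simp flip: less_top)
  then show ?thesis
    using assms by (simp add: cumulant_mgf)
qed

end

section \<open>The constants \<open>c\<^sub>+\<close> and \<open>c\<^sub>-\<close>\<close>

text \<open>Admissibility is isolated so that infima can be compared constant by constant.\<close>

definition c_bound :: "'a measure \<Rightarrow> ('a \<Rightarrow> real) \<Rightarrow> real \<Rightarrow> bool" where
  "c_bound M W c \<longleftrightarrow> c \<ge> 0 \<and> (\<forall>t::real. 0 \<le> t \<and> ereal t < 1 / ereal c \<longrightarrow>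
     cumulant M W t \<le> ereal (prob_space.variance M W * t\<^sup>2 / (2 * (1 - c * t))))"

lemma c_plus_bound: "c_plus M W = Inf (ennreal ` {c. c_bound M W c})"
  unfolding c_plus_def c_bound_def by (rule arg_cong[of _ _ Inf]) auto

lemma less_inverse_ereal_iff:
  assumes "0 \<le> c" "0 \<le> t"
  shows "ereal t < 1 / ereal c \<longleftrightarrow> c * t < 1"
  using assms by (cases "c = 0") (auto simp: divide_ereal_def field_simps one_ereal_def)

text \<open>The positive finite factor \<open>s\<close> cancels from the inequality, also where the
  cumulant is infinite, so both variables admit the same constants.\<close>

lemma c_plus_scaled_cumulant:
  assumes "0 < s" "\<And>t. cumulant N Y t = ereal s * cumulant M X t"
    and "prob_space.variance N Y = s * prob_space.variance M X"
  shows "c_plus N Y = c_plus M X"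
proof -
  have "cumulant N Y t \<le> ereal (prob_space.variance N Y * t\<^sup>2 / (2 * (1 - c * t))) \<longleftrightarrow>
      cumulant M X t \<le> ereal (prob_space.variance M X * t\<^sup>2 / (2 * (1 - c * t)))" for c t
  proof -
    have rhs: "ereal (prob_space.variance N Y * t\<^sup>2 / (2 * (1 - c * t))) =
        ereal s * ereal (prob_space.variance M X * t\<^sup>2 / (2 * (1 - c * t)))"
      by (simp add: assms(3) mult.assoc)
    have cancel: "ereal s * x \<le> ereal s * y \<longleftrightarrow> x \<le> y" for x y
      using \<open>0 < s\<close> by (simp add: ereal_mult_le_mult_iff)
    show ?thesis
      unfolding assms(2) rhs cancel ..
  qed
  then show ?thesis
    by (simp add: c_plus_bound c_bound_def)
qed

section \<open>Scaling and reflection\<close>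

lemma cumulant_cmult: "cumulant M (\<lambda>\<omega>. b * W \<omega>) t = cumulant M W (b * t)"
  by (simp add: cumulant_def ac_simps)

lemma cumulant_uminus: "cumulant M (\<lambda>\<omega>. - W \<omega>) t = cumulant M W (- t)"
  by (simp add: cumulant_def)

lemma variance_cmult:
  fixes W :: "'a \<Rightarrow> real"
  shows "prob_space.variance M (\<lambda>\<omega>. b * W \<omega>) = b\<^sup>2 * prob_space.variance M W"
proof -
  have "(b * W \<omega> - b * (\<integral>\<omega>. W \<omega> \<partial>M))\<^sup>2 = b\<^sup>2 * (W \<omega> - (\<integral>\<omega>. W \<omega> \<partial>M))\<^sup>2" for \<omega>
    by (simp add: power_mult_distrib flip: right_diff_distrib)
  then show ?thesis by simp
qed

lemma variance_uminus:
  fixes W :: "'a \<Rightarrow> real"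
  shows "prob_space.variance M (\<lambda>\<omega>. - W \<omega>) = prob_space.variance M W"
  using variance_cmult[of M "-1" W] by simp

text \<open>The bound for the scaled variable is read at \<open>t / b\<close>, which lies in its
  range exactly when \<open>t\<close> lies in the range for \<open>c / b\<close>; the factor
  \<open>b\<^sup>2\<close> in the variance then cancels.\<close>

lemma c_bound_cmult:
  assumes "0 < b" "c_bound M (\<lambda>\<omega>. b * W \<omega>) c"
  shows "c_bound M W (c / b)"
  unfolding c_bound_def
proof (intro conjI allI impI)
  show "0 \<le> c / b" using assms by (simp add: c_bound_def)
  fix t assume t: "0 \<le> t \<and> ereal t < 1 / ereal (c / b)"
  have "0 \<le> c" using assms by (simp add: c_bound_def)
  have "c / b * t < 1"
    using t less_inverse_ereal_iff[of "c / b" t] \<open>0 \<le> c\<close> \<open>0 < b\<close> by simp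
  then have "0 \<le> t / b \<and> ereal (t / b) < 1 / ereal c"
    using t less_inverse_ereal_iff[of c "t / b"] \<open>0 \<le> c\<close> \<open>0 < b\<close> by simp
  then have "cumulant M (\<lambda>\<omega>. b * W \<omega>) (t / b) \<le>
      ereal (prob_space.variance M (\<lambda>\<omega>. b * W \<omega>) * (t / b)\<^sup>2 / (2 * (1 - c * (t / b))))"
    using assms(2) unfolding c_bound_def by blast
  then show "cumulant M W t \<le> ereal (prob_space.variance M W * t\<^sup>2 / (2 * (1 - c / b * t)))"
    unfolding cumulant_cmult variance_cmult using \<open>0 < b\<close> by (simp add: power_divide)
qed

lemma c_plus_cmult_ge:
  assumes "0 < b"
  shows "ennreal b * c_plus M W \<le> c_plus M (\<lambda>\<omega>. b * W \<omega>)"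
  unfolding c_plus_bound[of M "\<lambda>\<omega>. b * W \<omega>"]
proof (rule Inf_greatest)
  fix x assume "x \<in> ennreal ` {c. c_bound M (\<lambda>\<omega>. b * W \<omega>) c}"
  then obtain c where c: "x = ennreal c" "c_bound M (\<lambda>\<omega>. b * W \<omega>) c" by auto
  have "c_plus M W \<le> ennreal (c / b)"
    unfolding c_plus_bound using c_bound_cmult[OF assms c(2)] by (intro Inf_lower) auto
  then have "ennreal b * c_plus M W \<le> ennreal b * ennreal (c / b)"
    by (rule mult_left_mono) simp
  also have "\<dots> = x"
    using assms c by (simp add: ennreal_mult[symmetric] c_bound_def)
  finally show "ennreal b * c_plus M W \<le> x" .
qed

lemma c_plus_cmult:
  assumes "0 < b"
  shows "c_plus M (\<lambda>\<omega>. b * W \<omega>) = ennreal b * c_plus M W"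
proof (rule antisym)
  have cancel: "ennreal b * ennreal (1 / b) = 1"
    using assms by (simp add: ennreal_mult[symmetric])
  \<comment> \<open>The reverse inequality is the same one for the factor \<open>1 / b\<close> and
    the variable \<open>b * W\<close>.\<close>
  have "ennreal (1 / b) * c_plus M (\<lambda>\<omega>. b * W \<omega>) \<le> c_plus M W"
    using c_plus_cmult_ge[of "1 / b" M "\<lambda>\<omega>. b * W \<omega>"] assms by simp
  then have "ennreal b * (ennreal (1 / b) * c_plus M (\<lambda>\<omega>. b * W \<omega>)) \<le> ennreal b * c_plus M W"
    by (rule mult_left_mono) simp
  then show "c_plus M (\<lambda>\<omega>. b * W \<omega>) \<le> ennreal b * c_plus M W"
    by (simp add: cancel flip: mult.assoc)
qed (rule c_plus_cmult_ge[OF assms])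

lemma c_minus_cmult:
  assumes "0 < b"
  shows "c_minus M (\<lambda>\<omega>. b * W \<omega>) = ennreal b * c_minus M W"
  using c_plus_cmult[OF assms, of M "\<lambda>\<omega>. - W \<omega>"] by (simp add: c_minus_def)

theorem proposition4p1:
  fixes M :: "'a measure" and X :: "'a \<Rightarrow> real"
  assumes "prob_space M"
    and "X \<in> borel_measurable M"
    and "integrable M (\<lambda>\<omega>. (X \<omega>)\<^sup>2)"
    and "prob_space.expectation M X = 0"
    and "\<not> (\<exists>a. AE \<omega> in M. X \<omega> = a)"
    and "prob_space.variance M X > 0"
    and "infinitely_divisible (distr M borel X)"
  shows "c_plus M (\<lambda>\<omega>. - X \<omega>) = c_minus M X \<and>
         c_minus M (\<lambda>\<omega>. - X \<omega>) = c_plus M X \<and>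
         (\<forall>b::real. b > 0 \<longrightarrow>
            c_plus M (\<lambda>\<omega>. b * X \<omega>) = ennreal b * c_plus M X \<and>
            c_minus M (\<lambda>\<omega>. b * X \<omega>) = ennreal b * c_minus M X) \<and>
         (\<forall>(N :: 'b measure) (L :: real \<Rightarrow> 'b \<Rightarrow> real) (s::real).
            levy_process N L \<and> distr N borel (L 1) = distr M borel X \<and> s > 0 \<longrightarrow>
            c_plus N (L s) = c_plus M X \<and> c_minus N (L s) = c_minus M X)"
proof (intro conjI allI impI)
  fix b :: real assume "b > 0"
  then show "c_plus M (\<lambda>\<omega>. b * X \<omega>) = ennreal b * c_plus M X"
    and "c_minus M (\<lambda>\<omega>. b * X \<omega>) = ennreal b * c_minus M X"
    by (rule c_plus_cmult c_minus_cmult)+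
next
  fix N :: "'b measure" and L :: "real \<Rightarrow> 'b \<Rightarrow> real" and s :: real
  assume asm: "levy_process N L \<and> distr N borel (L 1) = distr M borel X \<and> s > 0"
  interpret prob_space N using asm by (simp add: levy_process_def)
  interpret levy N L using asm by unfold_locales simp
  have law: "law 1 = distr M borel X" and "0 < s"
    using asm by (simp_all add: law_def)
  \<comment> \<open>\<open>L 1\<close> and \<open>X\<close> live on different spaces, so the
    comparison goes through their common law.\<close>
  have "mgf N (L 1) t = mgf M X t" for t
    using mgf_law[of 1 t] mgf_distr[OF assms(2), of t] by (simp add: law)
  then have "cumulant N (L 1) t = cumulant M X t" for t
    by (simp add: cumulant_mgf)
  then have cumulant: "cumulant N (L s) t = ereal s * cumulant M X t" for t
    using cumulant_linear[OF \<open>0 < s\<close>] by simp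
  have "integrable (law 1) (\<lambda>x. x\<^sup>2)"
    unfolding law using assms(2,3) by (subst integrable_distr_eq) auto
  moreover have "variance (L 1) = prob_space.variance M X"
    using variance_law[of 1] variance_distr[OF assms(2)] by (simp add: law)
  ultimately have variance: "variance (L s) = s * prob_space.variance M X"
    using variance_linear[OF _ \<open>0 < s\<close>] by simp
  show "c_plus N (L s) = c_plus M X"
    using \<open>0 < s\<close> cumulant variance by (rule c_plus_scaled_cumulant)
  show "c_minus N (L s) = c_minus M X"
    \<comment> \<open>Reflection turns \<open>t\<close> into \<open>- t\<close> and preserves the
      variance; the scaling of the cumulant holds at every real \<open>t\<close>, so it applies to
      the reflected variables too.\<close>
    unfolding c_minus_def
    using \<open>0 < s\<close> cumulant variance
    by (intro c_plus_scaled_cumulant) (auto simp only: cumulant_uminus variance_uminus)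
qed (simp_all add: c_minus_def)

end
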